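(* There is a constant $C>0$ such that for every even integer $k\ge 2$, $$\frac{1}{6}k^2-Ck\le M(1,1,k)\le \frac14 k^2+Ck.$$
   Context: For a positive integer $n$, $[n]=\{1,\ldots,n\}$; for $f:[n]\to\mathbb Z$ and $Y\subseteq[n]$, $f(Y)=\sum_{y\in Y}f(y)$. A $k$-term arithmetic progression in $[n]$ is a set $\{a,a+d,\ldots,a+(k-1)d\}\subseteq[n]$ with $d$ a positive integer. For positive integers $r,s,k$ with $r+s\mid k$, $M(r,s,k)$ is the minimum value such that for every $n\ge M(r,s,k)$ and every $f:[n]\to\{-r,s\}$ with $f([n])=0$, there is a $k$-term arithmetic progression $A\subseteq[n]$ with $f(A)=0$. *)

theory Defs
  imports Complex_Main "HOL-Library.Extended_Real"
begin

definition is_AP :: "nat \<Rightarrow> nat \<Rightarrow> nat set \<Rightarrow> bool" where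
  "is_AP k n A \<longleftrightarrow>
     (\<exists>a d. d > 0 \<and> A = (\<lambda>i. a + i * d) ` {..<k} \<and> A \<subseteq> {1..n})"

definition has_zero_sum_AP :: "nat \<Rightarrow> nat \<Rightarrow> nat \<Rightarrow> nat \<Rightarrow> bool" where
  "has_zero_sum_AP r s k n \<longleftrightarrow>
     (\<forall>f :: nat \<Rightarrow> int. (\<forall>x\<in>{1..n}. f x \<in> {- int r, int s}) \<and> sum f {1..n} = 0 \<longrightarrow>
        (\<exists>A. is_AP k n A \<and> sum f A = 0))"

text \<open>The value is taken in the extended naturals, so that it is \<open>\<infinity>\<close> (and not an arbitrary
  number) if no threshold exists; a finite value is the minimum of the set of thresholds.\<close>

definition M :: "nat \<Rightarrow> nat \<Rightarrow> nat \<Rightarrow> enat" where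
  "M r s k = Inf (enat ` {m. m > 0 \<and> (\<forall>n\<ge>m. has_zero_sum_AP r s k n)})"

end

theory Submission imports Defs "HOL-Number_Theory.Cong" begin

text \<open>
  Upper bound: already the progressions with difference \<open>1\<close> suffice. The sums over consecutive blocks
  of length \<open>k\<close> are even and change by at most \<open>2\<close> when the block is shifted by one, so if none
  vanishes, they all have the same sign, say positive. Write \<open>n = m * k + r\<close> with \<open>r < k\<close>. As the
  \<open>m\<close> disjoint blocks contribute at least \<open>2 * m\<close>, the last \<open>r\<close> terms sum to at most \<open>- 2 * m\<close>; as
  the last \<open>k\<close> terms sum to at least \<open>2\<close>, the \<open>k - r\<close> terms before them sum to at least
  \<open>2 * m + 2\<close>. Hence \<open>4 * m + 2 \<le> k\<close>.

  Lower bound: take \<open>f\<close> with the odd period \<open>q = k + 1\<close> and sum \<open>3\<close> over each period, the negative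
  values being placed first, and cut it after about \<open>k / 6\<close> periods and a run of negative values.
  The sum over a \<open>k\<close>-term progression with difference \<open>d\<close> differs by \<open>1\<close> from the sum \<open>T\<close> over the
  progression prolonged to \<open>q\<close> terms. If \<open>d\<close> is coprime to \<open>q\<close>, then \<open>T = 3\<close>; otherwise \<open>T\<close> is a
  multiple of \<open>gcd d q > 1\<close>. In both cases \<open>T \<noteq> 1\<close> and \<open>T \<noteq> - 1\<close>.
\<close>

section \<open>Upper bound\<close>

text \<open>Throughout this section \<open>P\<close> stands for the prefix sums of a sequence with
  values 1 and -1, so block sums are differences \<open>P (a + b) - P a\<close>.\<close>

lemma unit_steps_bound:
  fixes P :: "nat \<Rightarrow> int"
  assumes step: "\<And>i. i < n \<Longrightarrow> P (Suc i) - P i \<in> {- 1, 1}"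
    and "a + b \<le> n"
  shows "\<bar>P (a + b) - P a\<bar> \<le> int b \<and> even (P (a + b) - P a - int b)"
  using assms(2)
proof (induction b)
  case (Suc b)
  have "P (Suc (a + b)) - P (a + b) \<in> {- 1, 1}"
    using step[of "a + b"] Suc.prems by simp
  then have s: "P (Suc (a + b)) = P (a + b) - 1 \<or> P (Suc (a + b)) = P (a + b) + 1"
    by auto
  have IH: "\<bar>P (a + b) - P a\<bar> \<le> int b" "even (P (a + b) - P a - int b)"
    using Suc by auto
  have "\<bar>P (Suc (a + b)) - P a\<bar> \<le> int (Suc b)"
    using s IH(1) by auto
  moreover have "even (P (Suc (a + b)) - P a - int (Suc b))"
    using s IH(2) by presburger
  ultimately show ?case by simp
qed simp

lemma block_increments_positive:
  fixes P :: "nat \<Rightarrow> int"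
  assumes step: "\<And>i. i < n \<Longrightarrow> P (Suc i) - P i \<in> {- 1, 1}"
    and "even k"
    and nonzero: "\<And>a. a + k \<le> n \<Longrightarrow> P (a + k) \<noteq> P a"
    and pos: "P k > P 0"
    and "a + k \<le> n"
  shows "P (a + k) - P a \<ge> 2"
  using assms(5)
proof (induction a)
  case 0
  have "even (P k - P 0 - int k)"
    using unit_steps_bound[where P = P and n = n, OF step, of 0 k] 0 by simp
  with pos \<open>even k\<close> have "P k - P 0 \<ge> 2" by presburger
  then show ?case by simp
next
  case (Suc a)
  have "P (Suc a) - P a \<in> {- 1, 1}" "P (Suc (a + k)) - P (a + k) \<in> {- 1, 1}"
    using step[of a] step[of "a + k"] Suc.prems by auto
  then have ge0: "P (Suc a + k) - P (Suc a) \<ge> 0"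
    using Suc by auto
  have "even (P (Suc a + k) - P (Suc a) - int k)"
    using unit_steps_bound[where P = P and n = n, OF step, of "Suc a" k] Suc.prems by simp
  with ge0 nonzero[OF Suc.prems] \<open>even k\<close> show ?case by presburger
qed

lemma positive_blocks_bound:
  fixes P :: "nat \<Rightarrow> int"
  assumes step: "\<And>i. i < n \<Longrightarrow> P (Suc i) - P i \<in> {- 1, 1}"
    and ends: "P n = P 0"
    and blocks: "\<And>a. a + k \<le> n \<Longrightarrow> P (a + k) - P a \<ge> 2"
    and "k > 0" "k \<le> n"
  shows "4 * (n div k) + 2 \<le> k"
proof -
  define m r where "m = n div k" and "r = n mod k"
  have n: "n = m * k + r" and "r < k"
    using \<open>k > 0\<close> by (auto simp: m_def r_def)
  have "P (j * k) - P 0 \<ge> 2 * int j" if "j \<le> m" for j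
    using that
  proof (induction j)
    case (Suc j)
    have "Suc j * k \<le> m * k"
      using Suc.prems by (rule mult_le_mono1)
    then have "j * k + k \<le> n"
      using n by simp
    from blocks[OF this] Suc show ?case
      by (simp add: add.commute)
  qed simp
  from this[of m] have m: "P (m * k) - P 0 \<ge> 2 * int m" by simp
  have "\<bar>P (m * k + r) - P (m * k)\<bar> \<le> int r"
    using unit_steps_bound[where P = P and n = n, OF step, of "m * k" r] n by simp
  then have 1: "2 * int m \<le> int r"
    using m n ends by simp
  \<comment> \<open>The final block of length \<open>k\<close> starts \<open>k - r\<close> places
    before \<open>m * k\<close>.\<close>
  have "n - k + (k - r) = m * k"
    using n \<open>r < k\<close> \<open>k \<le> n\<close> by simp
  then have "\<bar>P (m * k) - P (n - k)\<bar> \<le> int (k - r)"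
    using unit_steps_bound[where P = P and n = n, OF step, of "n - k" "k - r"] n by simp
  moreover have "P n - P (n - k) \<ge> 2"
    using blocks[of "n - k"] \<open>k \<le> n\<close> by simp
  ultimately have "2 * int m + 2 \<le> int (k - r)"
    using m ends by simp
  with 1 \<open>r < k\<close> show ?thesis
    by (simp add: m_def)
qed

lemma exists_zero_block:
  fixes P :: "nat \<Rightarrow> int"
  assumes step: "\<And>i. i < n \<Longrightarrow> P (Suc i) - P i \<in> {- 1, 1}"
    and ends: "P n = P 0"
    and "h > 0" and n: "h * h + 2 * h \<le> n"
  shows "\<exists>a. a + 2 * h \<le> n \<and> P (a + 2 * h) = P a"
proof (rule ccontr)
  let ?k = "2 * h"
  assume "\<not> ?thesis"
  then have nonzero: "P (a + ?k) \<noteq> P a" if "a + ?k \<le> n" for a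
    using that by blast
  have "?k \<le> n" "?k > 0" using n \<open>h > 0\<close> by auto
  have bound: "4 * (n div ?k) + 2 \<le> ?k"
  proof (cases "P ?k > P 0")
    case True
    show ?thesis
      using positive_blocks_bound[where P = P, OF step ends _ \<open>?k > 0\<close> \<open>?k \<le> n\<close>]
        block_increments_positive[where P = P, OF step _ nonzero True] by simp
  next
    case False
    \<comment> \<open>Negation preserves the hypotheses and makes the first block positive.\<close>
    define Q where "Q i = - P i" for i
    have Qstep: "Q (Suc i) - Q i \<in> {- 1, 1}" if "i < n" for i
      using step[OF that] by (auto simp: Q_def)
    have Qends: "Q n = Q 0" using ends by (simp add: Q_def)
    have Qnonzero: "Q (a + ?k) \<noteq> Q a" if "a + ?k \<le> n" for a
      using nonzero[OF that] by (simp add: Q_def)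
    have Qpos: "Q ?k > Q 0"
      using False nonzero[of 0] \<open>?k \<le> n\<close> by (simp add: Q_def)
    show ?thesis
      using positive_blocks_bound[where P = Q, OF Qstep Qends _ \<open>?k > 0\<close> \<open>?k \<le> n\<close>]
        block_increments_positive[where P = Q, OF Qstep _ Qnonzero Qpos] by simp
  qed
  \<comment> \<open>For \<open>k = 2 * h\<close> the bound reads
    \<open>2 * (n div k) + 1 \<le> h\<close>, which forces \<open>n < h * h + h\<close>.\<close>
  have "n < (n div ?k) * ?k + ?k"
    using \<open>?k > 0\<close> by (metis add.commute add_less_cancel_right div_mult_mod_eq mod_less_divisor add_less_cancel_left)
  also have "\<dots> = (2 * (n div ?k) + 1) * h + h"
    by (simp add: algebra_simps)
  also have "\<dots> \<le> h * h + h"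
    using bound by (intro add_mono mult_le_mono1) auto
  finally show False using n by simp
qed

lemma has_zero_sum_AP_large:
  assumes "h > 0" and "h * h + 2 * h \<le> n"
  shows "has_zero_sum_AP 1 1 (2 * h) n"
  unfolding has_zero_sum_AP_def
proof (intro allI impI, elim conjE)
  fix f :: "nat \<Rightarrow> int"
  assume f: "\<forall>x\<in>{1..n}. f x \<in> {- int 1, int 1}" and total: "sum f {1..n} = 0"
  define P where "P j = sum f {1..j}" for j
  have "\<exists>a. a + 2 * h \<le> n \<and> P (a + 2 * h) = P a"
  proof (rule exists_zero_block)
    show "P (Suc i) - P i \<in> {- 1, 1}" if "i < n" for i
      using that f[rule_format, of "Suc i"] by (simp add: P_def)
  qed (use assms total in \<open>simp_all add: P_def\<close>)
  then obtain a where a: "a + 2 * h \<le> n" "P (a + 2 * h) = P a" by blast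
  let ?A = "{Suc a..a + 2 * h}"
  have "{1..a + 2 * h} = {1..a} \<union> ?A" by auto
  then have "P (a + 2 * h) = P a + sum f ?A"
    by (simp add: P_def sum.union_disjoint)
  then have "sum f ?A = 0" using a by simp
  moreover have "?A = (\<lambda>i. Suc a + i * 1) ` {..<2 * h}"
    by (auto simp: image_iff Bex_def) presburger
  then have "is_AP (2 * h) n ?A"
    unfolding is_AP_def using a(1) by (intro exI[of _ "Suc a"] exI[of _ 1]) auto
  ultimately show "\<exists>A. is_AP (2 * h) n A \<and> sum f A = 0" by blast
qed

section \<open>Lower bound\<close>

lemma sum_periodic:
  fixes F :: "nat \<Rightarrow> 'a::semiring_1"
  assumes "\<And>i. F (i + t) = F i"
  shows "sum F {..<e * t} = of_nat e * sum F {..<t}"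
proof (induction e)
  case (Suc e)
  have "F (i + j * t) = F i" for i j
  proof (induction j)
    case (Suc j)
    show ?case using assms[of "i + j * t"] Suc by (simp add: ac_simps)
  qed simp
  then have "sum F {e * t..<e * t + t} = sum F {..<t}"
    using sum.shift_bounds_nat_ivl[of F 0 "e * t" t] by (simp add: add.commute lessThan_atLeast0)
  moreover have "sum F {..<Suc e * t} = sum F {..<e * t} + sum F {e * t..<e * t + t}"
    by (subst sum.atLeastLessThan_concat[of 0 "e * t", symmetric, unfolded atLeast0LessThan])
      (simp_all add: add.commute lessThan_atLeast0 sum.atLeastLessThan_concat)
  ultimately show ?case using Suc by (simp add: algebra_simps)
qed simp

text \<open>Multiplication by a unit followed by a translation permutes the residues modulo
  \<open>q\<close>.\<close>

lemma sum_AP_coprime: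
  fixes F :: "nat \<Rightarrow> 'a::comm_monoid_add"
  assumes periodic: "\<And>x. F (x mod q) = F x" and "coprime d q" "q > 0"
  shows "(\<Sum>i<q. F (c + i * d)) = sum F {..<q}"
proof -
  have inj: "inj_on (\<lambda>i. (c + i * d) mod q) {..<q}"
  proof (rule inj_onI)
    fix i j assume ij: "i \<in> {..<q}" "j \<in> {..<q}" "(c + i * d) mod q = (c + j * d) mod q"
    then have "[i * d = j * d] (mod q)"
      using cong_add_lcancel_nat unfolding cong_def[symmetric] by blast
    then have "[i = j] (mod q)"
      using cong_mult_rcancel_nat[of d q] \<open>coprime d q\<close> by simp
    with ij show "i = j" by (simp add: cong_def)
  qed
  have "(\<lambda>i. (c + i * d) mod q) ` {..<q} \<subseteq> {..<q}"
    using \<open>q > 0\<close> by auto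
  then have "bij_betw (\<lambda>i. (c + i * d) mod q) {..<q} {..<q}"
    using inj by (simp add: bij_betw_def endo_inj_surj)
  then have "(\<Sum>i<q. F ((c + i * d) mod q)) = sum F {..<q}"
    by (rule sum.reindex_bij_betw)
  then show ?thesis by (simp add: periodic)
qed

text \<open>Modulo \<open>q\<close> the progression returns to its start after
  \<open>q div gcd d q\<close> steps, so its \<open>q\<close> terms repeat one cycle
  \<open>gcd d q\<close> times.\<close>

lemma gcd_dvd_sum_AP:
  fixes F :: "nat \<Rightarrow> int"
  assumes periodic: "\<And>x. F (x mod q) = F x"
  shows "int (gcd d q) dvd (\<Sum>i<q. F (c + i * d))"
proof -
  obtain t where t: "q = gcd d q * t" by (metis dvdE gcd_dvd2)
  obtain u where u: "d = gcd d q * u" by (metis dvdE gcd_dvd1)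
  have "t * d = q * u"
    by (subst u, subst (2) t) simp
  have "F (c + (i + t) * d) = F (c + i * d)" for i
  proof -
    have "c + (i + t) * d = c + i * d + q * u"
      using \<open>t * d = q * u\<close> by (simp add: algebra_simps)
    then have "(c + (i + t) * d) mod q = (c + i * d) mod q" by (simp only: mod_mult_self2)
    then show ?thesis by (metis periodic)
  qed
  from sum_periodic[where F = "\<lambda>i. F (c + i * d)", OF this, of "gcd d q"] t
  have "(\<Sum>i<q. F (c + i * d)) = of_nat (gcd d q) * (\<Sum>i<t. F (c + i * d))"
    by simp
  then show ?thesis by simp
qed

lemma sum_AP_nonzero:
  fixes F :: "nat \<Rightarrow> int"
  assumes periodic: "\<And>x. F (x mod Suc k) = F x"
    and vals: "\<And>x. F x \<in> {- 1, 1}"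
    and total: "sum F {..<Suc k} = 3"
  shows "(\<Sum>i<k. F (c + i * d)) \<noteq> 0"
proof -
  define T where "T = (\<Sum>i<Suc k. F (c + i * d))"
  \<comment> \<open>This excludes 1 and -1 at once. If the sum over \<open>k\<close> terms vanished,
    \<open>T\<close> would equal its last term, a unit.\<close>
  have "\<not> T dvd 1"
  proof (cases "coprime d (Suc k)")
    case True
    then have "T = 3"
      using sum_AP_coprime[where F = F, OF periodic True] total by (simp add: T_def)
    then show ?thesis by simp
  next
    case False
    show ?thesis
    proof
      assume "T dvd 1"
      moreover have "int (gcd d (Suc k)) dvd T"
        unfolding T_def by (rule gcd_dvd_sum_AP[where F = F, OF periodic])
      ultimately have "int (gcd d (Suc k)) dvd int 1"
        by (metis dvd_trans of_nat_1)
      then have "gcd d (Suc k) = 1"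
        by (simp only: int_dvd_int_iff nat_dvd_1_iff_1)
      with False show False
        by (simp only: coprime_iff_gcd_eq_1)
    qed
  qed
  moreover have "T = (\<Sum>i<k. F (c + i * d)) + F (c + k * d)"
    by (simp add: T_def)
  moreover have "F (c + k * d) dvd 1"
    using vals[of "c + k * d"] by auto
  ultimately show ?thesis by auto
qed

text \<open>Each period of length \<open>2 * h + 3\<close> has \<open>h\<close> negative and
  \<open>h + 3\<close> positive values. After \<open>m\<close> periods the sum \<open>3 * m\<close>
  is cancelled by \<open>3 * m\<close> further negative values, available in a row as
  \<open>3 * m \<le> h\<close>; the total length is \<open>m * (2 * h + 6)\<close>.\<close>

lemma not_has_zero_sum_AP:
  assumes m: "3 * m \<le> h"
  shows "\<not> has_zero_sum_AP 1 1 (2 * h + 2) (m * (2 * h + 6))"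
proof
  define k where "k = 2 * h + 2"
  define n where "n = m * (2 * h + 6)"
  assume "has_zero_sum_AP 1 1 (2 * h + 2) (m * (2 * h + 6))"
  then have has: "has_zero_sum_AP 1 1 k n" by (simp add: k_def n_def)
  define F :: "nat \<Rightarrow> int" where "F x = (if x mod Suc k < h then - 1 else 1)" for x
  have periodic: "F (x mod Suc k) = F x" for x by (simp add: F_def)
  have vals: "F x \<in> {- 1, 1}" for x by (simp add: F_def)
  have head: "sum F {..<j} = - int j" if "j \<le> h" for j
  proof -
    have "sum F {..<j} = (\<Sum>i<j. - 1)"
      using that by (intro sum.cong) (auto simp: F_def k_def)
    then show ?thesis by simp
  qed
  have "sum F {h..<Suc k} = (\<Sum>i=h..<Suc k. 1)"
    by (intro sum.cong) (auto simp: F_def)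
  then have "sum F {h..<Suc k} = int h + 3" by (simp add: k_def)
  moreover have "sum F {..<Suc k} = sum F {..<h} + sum F {h..<Suc k}"
    using sum.atLeastLessThan_concat[of 0 h "Suc k" F] by (simp add: k_def lessThan_atLeast0)
  ultimately have total: "sum F {..<Suc k} = 3"
    using head[of h] by simp
  have shift: "F (i + j * Suc k) = F i" for i j by (simp add: F_def del: mult_Suc_right)
  have "sum F {..<m * Suc k} = 3 * int m"
    using sum_periodic[of F "Suc k" m] shift[of _ 1] total by simp
  moreover have "sum F {m * Suc k..<m * Suc k + 3 * m} = sum F {..<3 * m}"
    using sum.shift_bounds_nat_ivl[of F 0 "m * Suc k" "3 * m"] shift
    by (simp add: add.commute lessThan_atLeast0 del: mult_Suc_right)
  moreover have "sum F {..<m * Suc k} + sum F {m * Suc k..<m * Suc k + 3 * m} = sum F {..<n}"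
    using sum.atLeastLessThan_concat[of 0 "m * Suc k" "m * Suc k + 3 * m" F]
    by (simp add: n_def k_def lessThan_atLeast0 algebra_simps)
  ultimately have "sum F {..<n} = 0" using head[OF m] by simp
  then have "(\<Sum>x=1..n. F (x - 1)) = 0"
    by (simp add: sum.atLeast1_atMost_eq)
  moreover have "\<forall>x\<in>{1..n}. F (x - 1) \<in> {- int 1, int 1}" using vals by simp
  ultimately obtain A where A: "is_AP k n A" "(\<Sum>x\<in>A. F (x - 1)) = 0"
    using has[unfolded has_zero_sum_AP_def, rule_format, of "\<lambda>x. F (x - 1)"] by blast
  then obtain a d where d: "d > 0" and img: "A = (\<lambda>i. a + i * d) ` {..<k}" and sub: "A \<subseteq> {1..n}"
    unfolding is_AP_def by blast
  \<comment> \<open>The first term lies in \<open>{1..n}\<close>, so the truncated subtraction in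
    \<open>F (x - 1)\<close> loses nothing.\<close>
  have "a + 0 * d \<in> A"
    unfolding img by (intro imageI) (simp add: k_def)
  then have "1 \<le> a" using sub by auto
  have "inj_on (\<lambda>i. a + i * d) {..<k}" using d by (auto intro: inj_onI)
  then have "(\<Sum>x\<in>A. F (x - 1)) = (\<Sum>i<k. F (a + i * d - 1))"
    unfolding img by (simp add: sum.reindex)
  also have "\<dots> = (\<Sum>i<k. F ((a - 1) + i * d))"
    using \<open>1 \<le> a\<close> by simp
  also have "\<dots> \<noteq> 0"
    by (rule sum_AP_nonzero[where F = F, OF periodic vals total])
  finally show False using A(2) by simp
qed

lemma M_ge:
  assumes "\<not> has_zero_sum_AP r s k n"
  shows "enat n \<le> M r s k"
  unfolding M_def
proof (rule Inf_greatest)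
  fix x assume "x \<in> enat ` {m. m > 0 \<and> (\<forall>n\<ge>m. has_zero_sum_AP r s k n)}"
  with assms show "enat n \<le> x" by (auto intro: leI)
qed

lemma M_le:
  assumes "m > 0" and "\<And>n. n \<ge> m \<Longrightarrow> has_zero_sum_AP r s k n"
  shows "M r s k \<le> enat m"
  unfolding M_def using assms by (intro Inf_lower) auto

theorem theorem1p12:
  "\<exists>C::real. C > 0 \<and> (\<forall>k::nat. even k \<and> k \<ge> 2 \<longrightarrow>
     ereal (1 / 6 * real k ^ 2 - C * real k) \<le> ereal_of_enat (M 1 1 k) \<and>
     ereal_of_enat (M 1 1 k) \<le> ereal (1 / 4 * real k ^ 2 + C * real k))"
proof (intro exI[of _ 3] conjI allI impI)
  fix k :: nat assume "even k \<and> k \<ge> 2"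
  then obtain h where k: "k = 2 * (h + 1)"
    by (metis One_nat_def Suc_eq_plus1 dvdE mult_eq_0_iff not_numeral_le_zero old.nat.exhaust)
  \<comment> \<open>The largest \<open>m\<close> with \<open>3 * m \<le> h\<close>.\<close>
  define m where "m = h div 3"
  have "enat (m * (2 * h + 6)) \<le> M 1 1 k"
    using M_ge[OF not_has_zero_sum_AP[of m h]] by (simp add: k m_def)
  then have "ereal_of_enat (enat (m * (2 * h + 6))) \<le> ereal_of_enat (M 1 1 k)"
    by (simp only: ereal_of_enat_le_iff)
  moreover have "1 / 6 * real k ^ 2 - 3 * real k \<le> real (m * (2 * h + 6))"
  proof -
    \<comment> \<open>Rounding costs only a linear term: the length is at least
      \<open>(k - 6) * (k + 4) / 6\<close>.\<close>
    have "h \<le> 3 * m + 2" unfolding m_def by linarith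
    then have "real h \<le> 3 * real m + 2" by linarith
    then have "(real h - 2) / 3 * (2 * real h + 6) \<le> real m * (2 * real h + 6)"
      by (intro mult_right_mono) auto
    then show ?thesis by (simp add: k power2_eq_square field_simps)
  qed
  ultimately show "ereal (1 / 6 * real k ^ 2 - 3 * real k) \<le> ereal_of_enat (M 1 1 k)"
    by (metis ereal_less_eq(3) ereal_of_enat_simps(1) order_trans)
  \<comment> \<open>In terms of \<open>k\<close> this is \<open>k ^ 2 / 4 + k\<close>.\<close>
  let ?N = "(h + 1) * (h + 1) + 2 * (h + 1)"
  have "M 1 1 k \<le> enat ?N"
    using has_zero_sum_AP_large[of "h + 1"] by (intro M_le) (auto simp: k)
  then have "ereal_of_enat (M 1 1 k) \<le> ereal_of_enat (enat ?N)"
    by (simp only: ereal_of_enat_le_iff)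
  moreover have "real ?N \<le> 1 / 4 * real k ^ 2 + 3 * real k"
    by (simp add: k power2_eq_square field_simps)
  ultimately show "ereal_of_enat (M 1 1 k) \<le> ereal (1 / 4 * real k ^ 2 + 3 * real k)"
    by (metis ereal_less_eq(3) ereal_of_enat_simps(1) order_trans)
qed simp

end
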